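(* Let $N\ge 1$ be an integer and let $\theta\ge 1$ be a real number. Let $g_{k,1},\ldots,g_{k,N}$ (with $k$ a fixed index) be real random variables on a common probability space, each exponentially distributed with unit mean, whose dependence is modeled by the $N$-dimensional Gumbel copula with parameter $\theta$. Let $g_k=\max\{g_{k,1},\ldots,g_{k,N}\}$. Then the cumulative distribution function $F_{g_k}(x)=\Pr(g_k\le x)$ is given, for every $x>0$, by $$F_{g_k}(x)=\exp\!\left(-\left(\sum_{n=1}^{N}\bigl[-\ln(1-e^{-x})\bigr]^{\theta}\right)^{1/\theta}\right).$$
   Context: The $d$-dimensional Gumbel copula with parameter $\theta\ge 1$ is the function $$C_{\mathrm G}(u_1,\ldots,u_d)=\exp\!\left(-\left(\sum_{i=1}^{d}(-\ln u_i)^{\theta}\right)^{1/\theta}\right),\qquad u_1,\ldots,u_d\in(0,1],$$ with value $0$ if some $u_i=0$. To say that the dependence of random variables $X_1,\ldots,X_d$ with continuous marginal CDFs $F_{X_1},\ldots,F_{X_d}$ is modeled by a copula $C$ means that their joint CDF satisfies $\Pr(X_1\le x_1,\ldots,X_d\le x_d)=C(F_{X_1}(x_1),\ldots,F_{X_d}(x_d))$ for all real $x_1,\ldots,x_d$. The unit-mean exponential distribution has CDF $1-e^{-x}$ for $x\ge 0$ (and $0$ for $x<0$). *)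

theory Defs
  imports "HOL-Probability.Probability"
begin

text \<open>Points of $[0,1]^d$ are functions on \<open>nat\<close>, of which only the components
  \<open>1, \<dots>, d\<close> matter.\<close>

definition gumbel_copula :: "nat \<Rightarrow> real \<Rightarrow> (nat \<Rightarrow> real) \<Rightarrow> real" where
  "gumbel_copula d \<theta> u =
     (if \<exists>i\<in>{1..d}. u i = 0 then 0
      else exp (- ((\<Sum>i=1..d. (- ln (u i)) powr \<theta>) powr (1 / \<theta>))))"

text \<open>The dependence of \<open>X 1, \<dots>, X d\<close> is modeled by \<open>C\<close>. This is meant for random
  variables with continuous marginal CDFs; measurability and continuity are not part of the
  predicate and have to come from the assumptions on the \<open>X i\<close>.\<close>

definition modeled_by_copula ::
    "'a measure \<Rightarrow> nat \<Rightarrow> (nat \<Rightarrow> 'a \<Rightarrow> real) \<Rightarrow> ((nat \<Rightarrow> real) \<Rightarrow> real) \<Rightarrow> bool" where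
  "modeled_by_copula M d X C \<longleftrightarrow>
     (\<forall>x :: nat \<Rightarrow> real.
        measure M {\<omega> \<in> space M. \<forall>i\<in>{1..d}. X i \<omega> \<le> x i} =
        C (\<lambda>i. cdf (distr M borel (X i)) (x i)))"

end

theory Submission
  imports Defs
begin

text \<open>A maximum of finitely many numbers is at most \<open>x\<close> exactly when each of them
  is, so the CDF of the maximum is the joint CDF of the \<open>g n\<close> on the diagonal point
  \<open>(x, ..., x)\<close>. The copula hypothesis turns this into \<open>gumbel_copula\<close>
  evaluated at the marginal CDFs, and by \<open>cdf_exponential\<close> each of these equals
  \<open>1 - exp (- x)\<close>. Independence is never assumed: all dependence enters through the
  copula.\<close>

lemma cdf_distr_eq:
  assumes "X \<in> borel_measurable M"
  shows "cdf (distr M borel X) x = measure M {\<omega> \<in> space M. X \<omega> \<le> x}"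
  using assms by (simp add: cdf_def measure_distr vimage_def Int_def conj_commute)

lemma cdf_exponential:
  assumes "prob_space M" and D: "distributed M lborel X (exponential_density 1)" and "x \<ge> 0"
  shows "cdf (distr M borel X) x = 1 - exp (- x)"
proof -
  interpret prob_space M by fact
  have "X \<in> borel_measurable M"
    using distributed_measurable[OF D] by simp
  then have "cdf (distr M borel X) x = prob {\<omega> \<in> space M. X \<omega> \<le> x}"
    by (rule cdf_distr_eq)
  also have "\<dots> = 1 - exp (- x)"
    using exponential_distributedD_le[OF D \<open>x \<ge> 0\<close>] by simp
  finally show ?thesis .
qed

theorem lemma1:
  fixes M :: "'a measure" and N :: nat and \<theta> :: real and g :: "nat \<Rightarrow> 'a \<Rightarrow> real"
  assumes "prob_space M"
    and "N \<ge> 1"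
    and "\<theta> \<ge> 1"
    and "\<forall>n\<in>{1..N}. distributed M lborel (g n) (exponential_density 1)"
    and "modeled_by_copula M N g (gumbel_copula N \<theta>)"
  shows "\<forall>x>0. cdf (distr M borel (\<lambda>\<omega>. Max ((\<lambda>n. g n \<omega>) ` {1..N}))) x =
           exp (- ((\<Sum>n=1..N. (- ln (1 - exp (- x))) powr \<theta>) powr (1 / \<theta>)))"
proof (intro allI impI)
  fix x :: real assume x: "x > 0"
  let ?G = "\<lambda>\<omega>. Max ((\<lambda>n. g n \<omega>) ` {1..N})"
  have meas: "g n \<in> borel_measurable M" if "n \<in> {1..N}" for n
    using that assms(4) distributed_measurable by fastforce
  \<comment> \<open>Measurability of the maximum is what lets \<open>cdf_distr_eq\<close> read its
    CDF as the probability of an event in \<open>M\<close>.\<close>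
  have G_meas: "?G \<in> borel_measurable M"
    using meas by (intro borel_measurable_Max) auto
  have marginal: "cdf (distr M borel (g n)) x = 1 - exp (- x)" if "n \<in> {1..N}" for n
    using that assms x by (intro cdf_exponential) auto
  have "cdf (distr M borel ?G) x = measure M {\<omega> \<in> space M. ?G \<omega> \<le> x}"
    using G_meas by (rule cdf_distr_eq)
  \<comment> \<open>\<open>N \<ge> 1\<close> makes the index set nonempty, so that
    \<open>Max\<close> is a genuine maximum.\<close>
  also have "\<dots> = measure M {\<omega> \<in> space M. \<forall>n\<in>{1..N}. g n \<omega> \<le> x}"
    using \<open>N \<ge> 1\<close> by (subst Max_le_iff) auto
  \<comment> \<open>The copula identity is taken at the constant threshold vector with all entries
    \<open>x\<close>.\<close>
  also have "\<dots> = gumbel_copula N \<theta> (\<lambda>n. cdf (distr M borel (g n)) x)"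
    using assms(5) by (simp add: modeled_by_copula_def)
  \<comment> \<open>Since \<open>x > 0\<close>, the common argument \<open>1 - exp (- x)\<close> is
    nonzero, which rules out the zero branch of \<open>gumbel_copula\<close>.\<close>
  also have "\<dots> = exp (- ((\<Sum>n=1..N. (- ln (1 - exp (- x))) powr \<theta>) powr (1 / \<theta>)))"
    using marginal x by (simp add: gumbel_copula_def)
  finally show "cdf (distr M borel ?G) x = \<dots>" .
qed

end
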